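(* For every integer $d$ with $1 \leq d \leq 5$ there is exactly one combinatorial type of Mani $d$-polytope, namely that of the $d$-dimensional crosspolytope. That is, the $d$-dimensional crosspolytope is a Mani $d$-polytope, and every Mani $d$-polytope is combinatorially equivalent to it.
   Context: A $d$-polytope is a convex polytope that is full-dimensional in $\mathbb{R}^d$. An inner diagonal of a $d$-polytope $P$ is a segment connecting two vertices of $P$ that passes through the interior of $P$. The polytope $P$ is illuminated if every vertex of $P$ lies on an inner diagonal, i.e. is an endpoint of some inner diagonal. For $d\ge 1$ set $M(d) := \min\{2d,\ d+1+\lceil 2\sqrt{d}\,\rceil\}$; by a theorem of Mani this is the minimum number of vertices of an illuminated $d$-polytope. A Mani $d$-polytope is an illuminated $d$-polytope with exactly $M(d)$ vertices. The $d$-dimensional crosspolytope is the convex hull of $\pm e_1,\dots,\pm e_d$ in $\mathbb{R}^d$, where $e_1,\dots,e_d$ are the standard basis vectors. Two polytopes have the same combinatorial type (are combinatorially equivalent) if their face lattices are isomorphic. *)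

theory Defs
  imports "HOL-Analysis.Analysis"
begin

definition full_dim_polytope :: "(real ^ 'n) set \<Rightarrow> bool" where
  "full_dim_polytope P \<longleftrightarrow> polytope P \<and> aff_dim P = int CARD('n)"

definition vertices :: "'a::real_vector set \<Rightarrow> 'a set" where
  "vertices P = {v. v extreme_point_of P}"

definition inner_diagonal ::
    "'a::real_normed_vector set \<Rightarrow> 'a \<Rightarrow> 'a \<Rightarrow> bool" where
  "inner_diagonal P v w \<longleftrightarrow>
     v \<in> vertices P \<and> w \<in> vertices P \<and> v \<noteq> w \<and>
     closed_segment v w \<inter> interior P \<noteq> {}"

definition illuminated :: "'a::real_normed_vector set \<Rightarrow> bool" where
  "illuminated P \<longleftrightarrow> (\<forall>v \<in> vertices P. \<exists>w. inner_diagonal P v w)"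

definition mani_number :: "nat \<Rightarrow> nat" where
  "mani_number d = min (2 * d) (d + 1 + nat \<lceil>2 * sqrt (real d)\<rceil>)"

definition mani_polytope :: "(real ^ 'n) set \<Rightarrow> bool" where
  "mani_polytope P \<longleftrightarrow>
     full_dim_polytope P \<and> illuminated P \<and> card (vertices P) = mani_number CARD('n)"

definition crosspolytope :: "(real ^ 'n) set" where
  "crosspolytope = convex hull (\<Union>i. {axis i 1, - axis i 1})"

text \<open>The relation \<open>face_of\<close> counts the empty set and the polytope itself as faces, so
  the faces form the full face lattice. An order isomorphism of lattices is a lattice
  isomorphism.\<close>

definition combinatorially_equivalent ::
    "'a::real_vector set \<Rightarrow> 'b::real_vector set \<Rightarrow> bool" where
  "combinatorially_equivalent P Q \<longleftrightarrow>
     (\<exists>f. bij_betw f {F. F face_of P} {G. G face_of Q} \<and>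
          (\<forall>F F'. F face_of P \<longrightarrow> F' face_of P \<longrightarrow> (F \<subseteq> F' \<longleftrightarrow> f F \<subseteq> f F')))"

end

theory Submission
  imports Defs
begin

text \<open>
  The endpoints of an inner diagonal never lie in a common facet. Cover the graph of inner
  diagonals by \<open>k\<close> disjoint stars, each having at least one leaf. Then \<open>k \<le> d\<close>, as there are
  \<open>2d\<close> vertices.

  If \<open>k < d\<close>, take a facet \<open>F\<close> through a centre \<open>c\<close> that contains as many centres as possible.
  It misses the leaves of its own centres and the remaining centres. As \<open>F\<close> has at least \<open>d\<close>
  vertices, \<open>c\<close> has at most \<open>d + 1 - k\<close> leaves, and equality would force \<open>F\<close> to be a simplex
  with a leaf \<open>w\<close> among its vertices; the facet across the ridge opposite to \<open>w\<close> would then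
  contain one more centre. So every star has at most \<open>d - k\<close> leaves, whence
  \<open>2d - k \<le> k(d - k)\<close>, which is impossible for \<open>d \<le> 5\<close>.

  If \<open>k = d\<close>, the stars form a perfect matching. Every facet then contains exactly one vertex of
  each pair, and crossing ridges exchanges the two vertices of a pair, so that all \<open>2 ^ d\<close>
  transversals are facets. The vertex-facet incidences determine the face lattice.
\<close>

section \<open>Incidence systems\<close>

text \<open>Vertices, facets as vertex sets, and inner diagonals as edges \<open>E\<close>: all the
  geometry that the combinatorial argument uses. \<open>flip\<close> crosses the ridge opposite to
  \<open>w\<close> in a simplex facet; \<open>A \<noteq> {w}\<close> excludes an empty
  ridge.\<close>

locale illuminated_incidence =
  fixes V :: "'a set" and \<F> :: "'a set set" and E :: "'a \<Rightarrow> 'a \<Rightarrow> bool" and d :: nat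
  assumes finite_V: "finite V"
    and facet_subset: "A \<in> \<F> \<Longrightarrow> A \<subseteq> V"
    and card_facet: "A \<in> \<F> \<Longrightarrow> d \<le> card A"
    and E_sym: "E v w \<Longrightarrow> E w v"
    and E_separated: "A \<in> \<F> \<Longrightarrow> E v w \<Longrightarrow> v \<in> A \<Longrightarrow> w \<notin> A"
    and covered: "v \<in> V \<Longrightarrow> \<exists>A\<in>\<F>. v \<in> A"
    and not_isolated: "v \<in> V \<Longrightarrow> \<exists>w\<in>V. E v w"
    and flip: "A \<in> \<F> \<Longrightarrow> card A = d \<Longrightarrow> w \<in> A \<Longrightarrow> A \<noteq> {w} \<Longrightarrow>
                 \<exists>B\<in>\<F>. A - {w} \<subseteq> B \<and> w \<notin> B"
begin

lemma E_irrefl: "v \<in> V \<Longrightarrow> \<not> E v v"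
  using covered E_separated by blast

section \<open>Covering the graph of inner diagonals by disjoint stars\<close>

text \<open>\<open>\<phi>\<close> sends each leaf to its centre, so its fibres are the leaf sets of
  the stars; that its image is all of \<open>C\<close> gives every centre a leaf.\<close>

definition star_cover :: "'a set \<Rightarrow> 'a set \<Rightarrow> ('a \<Rightarrow> 'a) \<Rightarrow> bool" where
  "star_cover U C \<phi> \<longleftrightarrow> U \<subseteq> V \<and> C \<subseteq> U \<and> \<phi> ` (U - C) = C \<and> (\<forall>v\<in>U - C. E v (\<phi> v))"

text \<open>Attach \<open>v\<close> to a neighbour \<open>w\<close>. An uncovered \<open>w\<close>
  founds a new star, a centre \<open>w\<close> gains a leaf, and a leaf \<open>w\<close> with a
  sibling leaves its star to become the centre of \<open>v\<close>. Without a sibling, the star of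
  \<open>w\<close> is a single edge and can be recentred.\<close>

lemma star_cover_insert:
  assumes sc: "star_cover U C \<phi>" and v: "v \<in> V"
  shows "\<exists>U' C' \<phi>'. insert v U \<subseteq> U' \<and> star_cover U' C' \<phi>'"
proof (cases "v \<in> U")
  case True
  then have "insert v U \<subseteq> U" by simp
  then show ?thesis using sc by (intro exI conjI[rotated]) (assumption, blast)
next
  case False
  have C: "U \<subseteq> V" "C \<subseteq> U" and \<phi>: "\<phi> ` (U - C) = C" and E: "\<forall>x\<in>U - C. E x (\<phi> x)"
    using sc by (auto simp: star_cover_def)
  obtain w where w: "w \<in> V" "E v w" using not_isolated v by blast
  have vw: "v \<noteq> w" using w v E_irrefl by auto
  have upd: "(\<phi>(v := w)) ` A = \<phi> ` A" if "A \<subseteq> U" for A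
    using that False by (intro image_cong) auto
  consider "w \<notin> U" | "w \<in> C" | "w \<in> U - C" "\<exists>x\<in>U - C. x \<noteq> w \<and> \<phi> x = \<phi> w"
    | "w \<in> U - C" "\<not> (\<exists>x\<in>U - C. x \<noteq> w \<and> \<phi> x = \<phi> w)" by blast
  then show ?thesis
  proof cases
    case 1
    have "star_cover (insert v (insert w U)) (insert w C) (\<phi>(v := w))"
    proof -
      have eq: "insert v (insert w U) - insert w C = insert v (U - C)"
        using 1 vw False C by blast
      have "(\<phi>(v := w)) ` (U - C) = C"
        using upd[of "U - C"] \<phi> by blast
      then have "(\<phi>(v := w)) ` insert v (U - C) = insert w C"
        by (simp only: image_insert fun_upd_same)
      moreover have "\<forall>x\<in>insert v (U - C). E x ((\<phi>(v := w)) x)" using E w by simp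
      ultimately show ?thesis unfolding star_cover_def eq using C v w by blast
    qed
    then show ?thesis by (intro exI conjI[rotated]) (assumption, blast)
  next
    case 2
    have "star_cover (insert v U) C (\<phi>(v := w))"
    proof -
      have eq: "insert v U - C = insert v (U - C)"
        using False C by blast
      have "(\<phi>(v := w)) ` (U - C) = C"
        using upd[of "U - C"] \<phi> by blast
      then have "(\<phi>(v := w)) ` insert v (U - C) = C"
        using 2 by (simp only: image_insert fun_upd_same insert_absorb)
      moreover have "\<forall>x\<in>insert v (U - C). E x ((\<phi>(v := w)) x)" using E w by simp
      ultimately show ?thesis unfolding star_cover_def eq using C v by blast
    qed
    then show ?thesis by (intro exI conjI[rotated]) (assumption, blast)
  next
    case 3
    have "star_cover (insert v U) (insert w C) (\<phi>(v := w))"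
    proof -
      have eq: "insert v U - insert w C = insert v (U - C - {w})"
        using False C vw by blast
      have "(\<phi>(v := w)) ` (U - C - {w}) = \<phi> ` (U - C - {w})" by (rule upd) blast
      \<comment> \<open>The sibling of \<open>w\<close> keeps the centre \<open>\<phi> w\<close> in
        the image.\<close>
      also have "\<dots> = \<phi> ` (U - C)"
      proof -
        obtain x where "x \<in> U - C - {w}" "\<phi> x = \<phi> w" using 3 by blast
        then have "\<phi> w \<in> \<phi> ` (U - C - {w})" by (metis image_eqI)
        then show ?thesis using 3(1) by (metis image_insert insert_Diff insert_absorb)
      qed
      finally have "(\<phi>(v := w)) ` (U - C - {w}) = C" unfolding \<phi> .
      then have "(\<phi>(v := w)) ` insert v (U - C - {w}) = insert w C"
        by (simp only: image_insert fun_upd_same)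
      moreover have "\<forall>x\<in>insert v (U - C - {w}). E x ((\<phi>(v := w)) x)" using E w by simp
      ultimately show ?thesis unfolding star_cover_def eq using C v 3(1) by blast
    qed
    then show ?thesis by (intro exI conjI[rotated]) (assumption, blast)
  next
    case 4
    \<comment> \<open>The edge from \<open>w\<close> to its centre is a star on its own, so its centre can be moved to \<open>w\<close>.\<close>
    define c where "c = \<phi> w"
    have c: "c \<in> C" "E w c" using 4(1) \<phi> E by (auto simp: c_def)
    then have cw: "c \<noteq> w" and cv: "c \<noteq> v" and cU: "c \<notin> U - C - {w}"
      using 4(1) C False by auto
    have "star_cover (insert v U) (insert w (C - {c})) (\<phi>(v := w, c := w))"
    proof -
      have eq: "insert v U - insert w (C - {c}) = insert v (insert c (U - C - {w}))"
        using False C vw c cw by blast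
      have "(\<phi>(v := w, c := w)) ` (U - C - {w}) = \<phi> ` (U - C - {w})"
        using False cU by (intro image_cong) auto
      \<comment> \<open>\<open>w\<close> is the only leaf of \<open>c\<close>, so dropping it loses
        exactly \<open>c\<close>.\<close>
      also have "\<dots> = \<phi> ` (U - C) - {c}"
      proof
        show "\<phi> ` (U - C - {w}) \<subseteq> \<phi> ` (U - C) - {c}" using 4(2) by (auto simp: c_def)
        show "\<phi> ` (U - C) - {c} \<subseteq> \<phi> ` (U - C - {w})" by (auto simp: c_def)
      qed
      finally have "(\<phi>(v := w, c := w)) ` (U - C - {w}) = C - {c}" unfolding \<phi> .
      moreover have "(\<phi>(v := w, c := w)) v = w" using cv by simp
      ultimately have "(\<phi>(v := w, c := w)) ` insert v (insert c (U - C - {w})) = insert w (C - {c})"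
        by (simp only: image_insert fun_upd_same insert_absorb2)
      moreover have "\<forall>x\<in>insert v (insert c (U - C - {w})). E x ((\<phi>(v := w, c := w)) x)"
        using E w E_sym[OF c(2)] by simp
      moreover have "insert v U \<subseteq> V" "insert w (C - {c}) \<subseteq> insert v U"
        using C v 4(1) by auto
      ultimately show ?thesis unfolding star_cover_def eq by blast
    qed
    then show ?thesis by (intro exI conjI[rotated]) (assumption, blast)
  qed
qed

lemma ex_star_cover: "\<exists>C \<phi>. star_cover V C \<phi>"
proof -
  have "\<exists>U C \<phi>. W \<subseteq> U \<and> star_cover U C \<phi>" if "finite W" "W \<subseteq> V" for W
    using that
  proof (induction W)
    case empty
    have "star_cover {} {} id" by (simp add: star_cover_def)
    then show ?case by blast
  next
    case (insert v W)
    then obtain U C \<phi> where U: "W \<subseteq> U" "star_cover U C \<phi>" by auto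
    obtain U' C' \<phi>' where "insert v U \<subseteq> U'" "star_cover U' C' \<phi>'"
      using star_cover_insert[OF U(2), of v] insert.prems by auto
    then show ?case using U(1) by blast
  qed
  from this[OF finite_V] obtain U C \<phi> where "V \<subseteq> U" "star_cover U C \<phi>" by blast
  moreover from this have "U = V" by (auto simp: star_cover_def)
  ultimately show ?thesis by blast
qed

section \<open>Bounding the stars\<close>

text \<open>If \<open>c\<close> had more leaves, counting the vertices missed by a facet through
  \<open>c\<close> would leave no slack. Flipping such a facet with the most centres then gives a
  contradiction.\<close>

lemma card_leaves_less:
  assumes sc: "star_cover V C \<phi>" and card_V: "card V = 2 * d" and k: "card C < d"
    and c: "c \<in> C"
  shows "card {v \<in> V - C. \<phi> v = c} + card C \<le> d"
proof (rule ccontr)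
  assume neg: "\<not> ?thesis"
  define L where "L = {v \<in> V - C. \<phi> v = c}"
  have C: "C \<subseteq> V" "\<phi> ` (V - C) = C" and E: "\<And>v. v \<in> V - C \<Longrightarrow> E v (\<phi> v)"
    using sc by (auto simp: star_cover_def)
  have fin: "finite C" using C(1) finite_V finite_subset by blast
  \<comment> \<open>The vertices that a facet \<open>A\<close> is sure to miss: the centres outside
    \<open>A\<close> and the leaves of the centres in \<open>A\<close>.\<close>
  define M where "M A = (C - A) \<union> {v \<in> V - C. \<phi> v \<in> A}" for A
  have tight: "card A = d" "V - A = M A" if A: "A \<in> \<F>" and cA: "c \<in> A" for A
  proof -
    have sub: "M A \<subseteq> V - A" using C(1) E E_separated[OF A] E_sym unfolding M_def by blast
    have finA: "finite A" and AV: "A \<subseteq> V"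
      using A facet_subset finite_V finite_subset by blast+
    have card_VA: "card (V - A) = 2 * d - card A" using AV finA card_V by (simp add: card_Diff_subset)
    have "card A \<le> 2 * d" using card_mono[OF finite_V AV] card_V by simp
    \<comment> \<open>The leaves of the centres in \<open>A\<close> other than \<open>c\<close>;
      each such centre has at least one.\<close>
    define R where "R = {v \<in> V - C. \<phi> v \<in> A \<inter> C - {c}}"
    have "A \<inter> C - {c} \<subseteq> \<phi> ` R"
    proof
      fix x assume x: "x \<in> A \<inter> C - {c}"
      then have "x \<in> \<phi> ` (V - C)" by (simp add: C(2))
      then obtain v where "v \<in> V - C" "\<phi> v = x" by blast
      then have "v \<in> R" using x by (simp add: R_def)
      then show "x \<in> \<phi> ` R" using \<open>\<phi> v = x\<close> by blast
    qed
    then have R: "card (A \<inter> C - {c}) \<le> card R"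
      using finite_V by (intro surj_card_le) (auto simp: R_def)
    have "card (A \<inter> C) = Suc (card (A \<inter> C - {c}))"
      using fin c cA card_Suc_Diff1[of "A \<inter> C" c] by simp
    moreover have "card (C - A) + card (A \<inter> C) = card C"
    proof -
      have "(C - A) \<union> (A \<inter> C) = C" "(C - A) \<inter> (A \<inter> C) = {}" by blast+
      then show ?thesis using fin card_Un_disjoint[of "C - A" "A \<inter> C"] by simp
    qed
    moreover have "M A = (C - A) \<union> (L \<union> R)"
    proof -
      have "\<phi> v \<in> C" if "v \<in> V - C" for v using that C(2) by (metis imageI)
      then show ?thesis using cA by (auto simp: M_def L_def R_def)
    qed
    moreover have "card ((C - A) \<union> (L \<union> R)) = card (C - A) + (card L + card R)"
    proof -
      have "L \<inter> R = {}" "(C - A) \<inter> (L \<union> R) = {}" by (auto simp: L_def R_def)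
      moreover have "finite L" "finite R" using finite_V by (auto simp: L_def R_def)
      ultimately show ?thesis using fin by (simp add: card_Un_disjoint)
    qed
    \<comment> \<open>Each centre other than \<open>c\<close> accounts for an element of
      \<open>M A\<close>, either itself or a leaf. Together with the leaves of \<open>c\<close>
      these are at least \<open>d\<close> elements, while \<open>V - A\<close> has at most
      \<open>d\<close>; so all estimates are equalities.\<close>
    ultimately have "card C + card L \<le> card (M A) + 1" using R by simp
    then have "d \<le> card (M A)" using neg by (simp add: L_def)
    moreover have "card (M A) \<le> card (V - A)" using sub finite_V by (intro card_mono) auto
    moreover have "d \<le> card A" using card_facet A by blast
    ultimately have "card A = d" "card (M A) = card (V - A)" using card_VA \<open>card A \<le> 2 * d\<close> by auto
    then show "card A = d" "V - A = M A"
      using card_subset_eq[OF _ sub] finite_V by auto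
  qed
  define S where "S = {A \<in> \<F>. c \<in> A}"
  have "\<exists>A. A \<in> S \<and> (\<forall>B. B \<in> S \<longrightarrow> card (B \<inter> C) \<le> card (A \<inter> C))"
  proof -
    have "c \<in> V" using c C(1) by blast
    then obtain A where "A \<in> S" using covered unfolding S_def by blast
    then show ?thesis
      using ex_has_greatest_nat[of "\<lambda>A. A \<in> S" A "\<lambda>A. card (A \<inter> C)" "card C + 1"] fin
      by (metis Suc_eq_plus1 card_mono inf_le2 less_Suc_eq_le)
  qed
  then obtain A where A: "A \<in> \<F>" "c \<in> A"
    and max: "\<And>B. B \<in> \<F> \<Longrightarrow> c \<in> B \<Longrightarrow> card (B \<inter> C) \<le> card (A \<inter> C)"
    by (auto simp: S_def)
  \<comment> \<open>As \<open>card A = d\<close> exceeds \<open>card C\<close>, the facet contains a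
    leaf \<open>w\<close>.\<close>
  have "\<not> A \<subseteq> C" using tight(1)[OF A] k fin card_mono by (metis not_le)
  then obtain w where w: "w \<in> A" "w \<notin> C" by blast
  have wV: "w \<in> V" using w A facet_subset by blast
  obtain B where B: "B \<in> \<F>" "A - {w} \<subseteq> B" "w \<notin> B"
    using flip[OF A(1) tight(1)[OF A] w(1)] A w c by blast
  have cB: "c \<in> B" using A B w c by blast
  \<comment> \<open>Only the leaf \<open>w\<close> is lost from \<open>A\<close>, so by maximality
    \<open>B\<close> has no new centre.\<close>
  have "A \<inter> C \<subseteq> B \<inter> C" using B w by blast
  then have eq: "A \<inter> C = B \<inter> C"
    using max[OF B(1) cB] fin by (intro card_seteq) auto
  \<comment> \<open>The tight facet \<open>B\<close> misses the leaf \<open>w\<close>, so it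
    contains the centre of \<open>w\<close>. That centre then lies in \<open>A\<close> together with
    \<open>w\<close>, although the two are joined by an edge.\<close>
  have "w \<in> M B" using tight(2)[OF B(1) cB] wV B by blast
  then have "\<phi> w \<in> B \<inter> C" using w(2) wV C(2) by (auto simp: M_def)
  then have "\<phi> w \<in> A" using eq by blast
  then show False using E_separated[OF A(1) E[of w]] w wV by blast
qed

text \<open>A star cover of \<open>2 * d\<close> vertices with \<open>d\<close> centres is a perfect
  matching, so it remains to exclude fewer centres.\<close>

lemma ex_perfect_matching:
  assumes card_V: "card V = 2 * d" and d: "1 \<le> d" "d \<le> 5"
  shows "\<exists>C \<phi>. C \<subseteq> V \<and> card C = d \<and> bij_betw \<phi> (V - C) C \<and> (\<forall>v\<in>V - C. E v (\<phi> v))"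
proof -
  obtain C \<phi> where sc: "star_cover V C \<phi>" using ex_star_cover by blast
  have C: "C \<subseteq> V" "\<phi> ` (V - C) = C" and E: "\<forall>v\<in>V - C. E v (\<phi> v)"
    using sc by (auto simp: star_cover_def)
  have fin: "finite C" using C(1) finite_V finite_subset by blast
  have VC: "card (V - C) = 2 * d - card C" using C fin card_V by (simp add: card_Diff_subset)
  have "card C \<le> card (V - C)" using C finite_V card_image_le by (metis finite_Diff)
  then have le: "card C \<le> d" using VC by linarith
  have "\<not> card C < d"
  proof
    assume less: "card C < d"
    have "card (V - C) = (\<Sum>c\<in>C. card {v \<in> V - C. \<phi> v = c})"
    proof -
      have "card (V - C) = card (\<Union>c\<in>C. {v \<in> V - C. \<phi> v = c})"
        using C by (intro arg_cong[where f = card]) blast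
      also have "\<dots> = (\<Sum>c\<in>C. card {v \<in> V - C. \<phi> v = c})"
        using fin finite_V by (intro card_UN_disjoint) auto
      finally show ?thesis .
    qed
    also have "\<dots> \<le> (\<Sum>c\<in>C. d - card C)"
      using card_leaves_less[OF sc card_V less] by (intro sum_mono) (simp add: le_diff_conv2 less_imp_le[OF less])
    finally have ineq: "2 * d - card C \<le> card C * (d - card C)" using VC by simp
    \<comment> \<open>A finite check, and the place where \<open>d \<le> 5\<close> matters: the
      inequality holds for \<open>d = 6\<close> and \<open>card C = 3\<close>.\<close>
    have "d = 1 \<or> d = 2 \<or> d = 3 \<or> d = 4 \<or> d = 5" using d by linarith
    moreover have "card C = 0 \<or> card C = 1 \<or> card C = 2 \<or> card C = 3 \<or> card C = 4"
      using d less by linarith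
    ultimately show False using ineq less by (elim disjE) simp_all
  qed
  then have "card C = d" using le by simp
  \<comment> \<open>With equally many leaves and centres, the surjection \<open>\<phi>\<close> is
    injective.\<close>
  moreover have "inj_on \<phi> (V - C)"
    using C VC \<open>card C = d\<close> finite_V by (intro eq_card_imp_inj_on) auto
  ultimately show ?thesis using C E unfolding bij_betw_def by blast
qed

text \<open>The labels imitate the pairs \<open>axis i 1\<close>, \<open>- axis i 1\<close>. An
  index type common to all polytopes lets their incidences be compared as sets of labels.\<close>

lemma ex_paired_labelling:
  assumes "card V = 2 * d" "CARD('n::finite) = d" "d \<le> 5"
  shows "\<exists>p :: 'n \<times> bool \<Rightarrow> 'a. bij_betw p UNIV V \<and> (\<forall>i. E (p (i, True)) (p (i, False)))"
proof -
  have "1 \<le> d" using assms(2) zero_less_card_finite[where 'a = 'n] by linarith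
  then obtain C \<phi> where C: "C \<subseteq> V" "card C = d" "bij_betw \<phi> (V - C) C" "\<forall>v\<in>V - C. E v (\<phi> v)"
    using ex_perfect_matching[OF assms(1) _ assms(3)] by blast
  obtain h :: "'n \<Rightarrow> 'a" where h: "bij_betw h UNIV C"
    using finite_same_card_bij[of "UNIV :: 'n set" C] finite_subset[OF C(1) finite_V] C(2) assms(2)
    by auto
  define \<psi> where "\<psi> = inv_into (V - C) \<phi>"
  have \<psi>: "bij_betw \<psi> C (V - C)" using C bij_betw_inv_into unfolding \<psi>_def by blast
  have \<phi>\<psi>: "\<phi> (\<psi> c) = c" if "c \<in> C" for c
    using that C unfolding \<psi>_def by (metis bij_betw_inv_into_right)
  have hC: "h i \<in> C" for i using h bij_betwE by blast
  have \<psi>VC: "\<psi> (h i) \<in> V - C" for i using \<psi> hC bij_betwE by blast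
  define p where "p = (\<lambda>(i, b). if b then \<psi> (h i) else h i)"
  have "inj p"
  proof (rule injI)
    fix x y assume eq: "p x = p y"
    obtain i b j b' where xy: "x = (i, b)" "y = (j, b')" by fastforce
    have "inj h" "inj_on \<psi> C" using h \<psi> by (auto simp: bij_betw_def)
    then have "\<psi> (h i) = \<psi> (h j) \<longleftrightarrow> i = j" "h i = h j \<longleftrightarrow> i = j"
      using hC by (auto simp: inj_eq inj_on_eq_iff)
    moreover have "h i \<noteq> \<psi> (h j)" "\<psi> (h i) \<noteq> h j"
      using \<psi>VC[of i] \<psi>VC[of j] hC[of i] hC[of j] by auto
    ultimately show "x = y" using eq by (cases b; cases b') (simp_all add: xy p_def)
  qed
  moreover have "range p = V"
  proof
    have "h i \<in> V" "\<psi> (h i) \<in> V" for i using \<psi>VC[of i] hC[of i] C(1) by auto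
    then show "range p \<subseteq> V" by (auto simp: p_def)
    show "V \<subseteq> range p"
    proof
      fix v assume v: "v \<in> V"
      show "v \<in> range p"
      proof (cases "v \<in> C")
        case True
        then obtain i where "v = h i" using h by (auto simp: bij_betw_def)
        then have "v = p (i, False)" by (simp add: p_def)
        then show ?thesis by blast
      next
        case False
        then have "v \<in> \<psi> ` C" using \<psi> v by (auto simp: bij_betw_def)
        then obtain i where "v = \<psi> (h i)" using h by (auto simp: bij_betw_def)
        then have "v = p (i, True)" by (simp add: p_def)
        then show ?thesis by blast
      qed
    qed
  qed
  moreover have "E (p (i, True)) (p (i, False))" for i
    using bspec[OF C(4) \<psi>VC[of i]] \<phi>\<psi>[OF hC[of i]] by (simp add: p_def)
  ultimately show ?thesis unfolding bij_betw_def by blast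
qed

section \<open>Facets as transversals of the pairs\<close>

text \<open>A facet has at most one vertex of each pair and at least \<open>d\<close> in all, so its
  label set is the graph of a choice function \<open>s\<close>. It then has exactly \<open>d\<close>
  vertices, and flips change \<open>s\<close> at one index at a time until every choice is
  reached.\<close>

lemma facets_eq_transversals:
  fixes p :: "'n::finite \<times> bool \<Rightarrow> 'a"
  assumes p: "bij_betw p UNIV V" and pE: "\<And>i. E (p (i, True)) (p (i, False))"
    and d: "CARD('n) = d"
  shows "(\<lambda>A. p -` A) ` \<F> = range (\<lambda>s. range (\<lambda>i. (i, s i)))"
proof -
  have inj: "inj p" and ran: "range p = V" using p by (auto simp: bij_betw_def)
  define tr where "tr s = range (\<lambda>i::'n. (i, s i))" for s :: "'n \<Rightarrow> bool"
  have card_tr: "card (tr s) = d" for s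
    unfolding tr_def using d by (subst card_image) (auto simp: inj_on_def)
  have tr_mem: "(i, b) \<in> tr s \<longleftrightarrow> b = s i" for i b s by (auto simp: tr_def)
  have trans: "p -` A = tr (\<lambda>i. p (i, True) \<in> A)" if A: "A \<in> \<F>" for A
  proof (rule card_seteq)
    have "p ` (p -` A) = A" using facet_subset[OF A] ran by auto
    then have "card (p -` A) = card A"
      using inj by (metis card_image inj_on_subset subset_UNIV)
    then show "card (tr (\<lambda>i. p (i, True) \<in> A)) \<le> card (p -` A)"
      using card_tr card_facet[OF A] by simp
    show "p -` A \<subseteq> tr (\<lambda>i. p (i, True) \<in> A)"
    proof
      fix x assume x: "x \<in> p -` A"
      obtain i b where ib: "x = (i, b)" by fastforce
      show "x \<in> tr (\<lambda>i. p (i, True) \<in> A)"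
        using x E_separated[OF A pE[of i]] unfolding ib tr_mem by (cases b) auto
    qed
  qed (simp add: tr_def)
  have im: "p ` (p -` A) = A" if "A \<in> \<F>" for A using facet_subset[OF that] ran by auto
  have flip_tr: "p ` tr (s(i := b)) \<in> \<F>" if s: "p ` tr s \<in> \<F>" for s i b
  proof (cases "b = s i")
    case True
    then show ?thesis using s by (simp add: fun_upd_idem)
  next
    case b: False
    define w where "w = p (i, s i)"
    have w: "w \<in> p ` tr s" by (simp add: w_def tr_mem)
    have "\<exists>B\<in>\<F>. p ` tr s - {w} \<subseteq> B \<and> w \<notin> B"
    \<comment> \<open>For \<open>d = 1\<close> the facet is a single vertex and \<open>flip\<close>
      does not apply; a facet through the opposite vertex serves instead.\<close>
    proof (cases "p ` tr s = {w}")
      case True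
      have "p (i, b) \<in> V" using ran by blast
      then obtain B where B: "B \<in> \<F>" "p (i, b) \<in> B" using covered by blast
      have "E (p (i, b)) w"
        using pE[of i] E_sym[OF pE[of i]] b unfolding w_def by (cases b) simp_all
      then have "w \<notin> B" using E_separated[OF B(1) _ B(2)] by simp
      then show ?thesis using True B(1) by (intro bexI[of _ B]) simp_all
    next
      case False
      have "card (p ` tr s) = d" using card_tr inj by (metis card_image inj_on_subset subset_UNIV)
      then show ?thesis using flip[OF s _ w False] by blast
    qed
    then obtain B where B: "B \<in> \<F>" "p ` tr s - {w} \<subseteq> B" "w \<notin> B" by blast
    obtain t where t: "p -` B = tr t" using trans[OF B(1)] by blast
    \<comment> \<open>The transversal \<open>B\<close> avoids \<open>w\<close>, so it takes the
      other vertex of pair \<open>i\<close>; it keeps the choices in all other pairs.\<close>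
    have "t = s(i := b)"
    proof
      fix j
      show "t j = (s(i := b)) j"
      proof (cases "j = i")
        case True
        have "(i, s i) \<notin> tr t" using B(3) unfolding w_def t[symmetric] by simp
        then show ?thesis using True b by (auto simp: tr_mem)
      next
        case False
        then have "p (j, s j) \<noteq> w" using inj by (auto simp: w_def inj_def)
        then have "p (j, s j) \<in> B" using B(2) by (auto simp: tr_def)
        then have "(j, s j) \<in> tr t" unfolding t[symmetric] by simp
        then show ?thesis using False by (simp add: tr_mem)
      qed
    qed
    then show ?thesis using im[OF B(1)] t B(1) by simp
  qed
  obtain s0 where s0: "p ` tr s0 \<in> \<F>"
  proof -
    obtain A where "A \<in> \<F>" using covered ran by blast
    then show thesis using that im trans by metis
  qed
  have all: "p ` tr s \<in> \<F>" for s
  proof -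
    \<comment> \<open>Move from \<open>s0\<close> to \<open>s\<close> one index at a time;
      \<open>X\<close> is the set of indices already changed.\<close>
    have "p ` tr (override_on s0 s X) \<in> \<F>" if "finite X" for X
      using that
    proof (induction X)
      case empty
      then show ?case using s0 by simp
    next
      case (insert i X)
      then show ?case using flip_tr[of "override_on s0 s X" i "s i"]
        by (simp only: override_on_insert)
    qed
    from this[of UNIV] show ?thesis by (simp add: override_on_def)
  qed
  have "(\<lambda>A. p -` A) ` \<F> = range tr"
  proof
    show "(\<lambda>A. p -` A) ` \<F> \<subseteq> range tr" using trans by auto
    show "range tr \<subseteq> (\<lambda>A. p -` A) ` \<F>"
    proof
      fix T assume "T \<in> range tr"
      then obtain s where "T = tr s" by blast
      then have "T = p -` (p ` tr s)" using inj by (simp add: inj_vimage_image_eq)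
      then show "T \<in> (\<lambda>A. p -` A) ` \<F>" using all by blast
    qed
  qed
  then show ?thesis by (simp add: tr_def[abs_def])
qed

end

section \<open>Vertices and facets of polytopes\<close>

lemma finite_vertices:
  fixes P :: "'a::euclidean_space set"
  shows "polytope P \<Longrightarrow> finite (vertices P)"
  unfolding vertices_def polytope_def
  by (metis extreme_points_of_convex_hull finite_subset)

text \<open>Krein-Milman for \<open>F\<close>, whose extreme points are the vertices of
  \<open>P\<close> lying in it.\<close>

lemma convex_hull_face_vertices:
  fixes P :: "'a::euclidean_space set"
  assumes "polytope P" "F face_of P"
  shows "convex hull (F \<inter> vertices P) = F"
proof -
  have "polytope F" using assms face_of_polytope_polytope by blast
  then have "F = convex hull {x. x extreme_point_of F}"
    using Krein_Milman_Minkowski polytope_imp_compact polytope_imp_convex by blast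
  moreover have "{x. x extreme_point_of F} = F \<inter> vertices P"
    using extreme_point_of_face[OF assms(2)] by (auto simp: vertices_def)
  ultimately show ?thesis by simp
qed

text \<open>The vertices of a facet affinely span it, and spanning dimension
  \<open>aff_dim P - 1\<close> takes at least \<open>aff_dim P\<close> points.\<close>

lemma card_facet_vertices:
  fixes P :: "'a::euclidean_space set"
  assumes "polytope P" "F facet_of P"
  shows "aff_dim P \<le> int (card (F \<inter> vertices P))"
proof -
  have "aff_dim F = aff_dim (F \<inter> vertices P)"
    using convex_hull_face_vertices[OF assms(1) facet_of_imp_face_of[OF assms(2)]]
    by (metis aff_dim_convex_hull)
  moreover have "aff_dim (F \<inter> vertices P) \<le> int (card (F \<inter> vertices P)) - 1"
    using finite_vertices[OF assms(1)] by (intro aff_dim_le_card) auto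
  ultimately show ?thesis using assms(2) by (simp add: facet_of_def)
qed

lemma inner_diagonal_sym: "inner_diagonal P v w \<Longrightarrow> inner_diagonal P w v"
  by (auto simp: inner_diagonal_def closed_segment_commute)

text \<open>Otherwise the whole segment would lie in a proper face, which misses the
  interior.\<close>

lemma inner_diagonal_not_in_facet:
  fixes P :: "'a::euclidean_space set"
  assumes "inner_diagonal P v w" "F facet_of P" "v \<in> F"
  shows "w \<notin> F"
proof
  assume "w \<in> F"
  have F: "F face_of P" "F \<noteq> P" using assms(2) by (auto simp: facet_of_def)
  have "closed_segment v w \<subseteq> F"
    using \<open>w \<in> F\<close> assms(3) face_of_imp_convex[OF F(1)] by (simp add: closed_segment_subset)
  then show False
    using assms(1) face_of_disjoint_interior[OF F] by (auto simp: inner_diagonal_def)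
qed

lemma vertex_in_facet:
  fixes P :: "'a::euclidean_space set"
  assumes "polytope P" "1 \<le> aff_dim P" "v \<in> vertices P"
  shows "\<exists>F. F facet_of P \<and> v \<in> F"
proof -
  have "{v} face_of P" using assms(3) by (simp add: vertices_def face_of_singleton)
  moreover have "{v} \<noteq> P" using assms(2) by auto
  ultimately show ?thesis
    using face_of_polyhedron_subset_facet[OF polytope_imp_polyhedron[OF assms(1)], of "{v}"]
    by (metis insert_not_empty insert_subset)
qed

text \<open>By its vertex count \<open>F\<close> is a simplex, so the vertices other than
  \<open>w\<close> span a face \<open>R\<close> of \<open>P\<close> that avoids \<open>w\<close>. A
  nonempty proper face is the intersection of the facets containing it, so one of these misses
  \<open>w\<close>.\<close>

lemma simplex_facet_flip:
  fixes P :: "'a::euclidean_space set"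
  assumes P: "polytope P" and F: "F facet_of P"
    and card: "int (card (F \<inter> vertices P)) = aff_dim P"
    and w: "w \<in> F \<inter> vertices P" "F \<inter> vertices P \<noteq> {w}"
  shows "\<exists>G. G facet_of P \<and> F \<inter> vertices P - {w} \<subseteq> G \<and> w \<notin> G"
proof -
  define A where "A = F \<inter> vertices P"
  have hull: "convex hull A = F"
    unfolding A_def using convex_hull_face_vertices[OF P facet_of_imp_face_of[OF F]] .
  have "aff_dim A = int (card A) - 1"
    using F card hull unfolding facet_of_def A_def by (metis aff_dim_convex_hull)
  moreover have "finite A" using finite_vertices[OF P] by (simp add: A_def)
  ultimately have indep: "\<not> affine_dependent A" by (simp add: affine_independent_iff_card)
  define R where "R = convex hull (A - {w})"
  have "R face_of F"
    using face_of_convex_hull_affine_independent[OF indep] hull unfolding R_def by blast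
  then have RP: "R face_of P" using F face_of_trans facet_of_imp_face_of by blast
  have wR: "w \<notin> R"
    using indep w convex_hull_subset_affine_hull unfolding R_def A_def affine_dependent_def by blast
  have "A - {w} \<noteq> {}" using w by (auto simp: A_def)
  then have "R \<noteq> {}" by (simp add: R_def)
  moreover have "R \<noteq> P" using wR w F facet_of_imp_subset by blast
  ultimately have "R = \<Inter>{G. G facet_of P \<and> R \<subseteq> G}"
    using face_of_polyhedron[OF polytope_imp_polyhedron[OF P] RP] by blast
  then obtain G where "G facet_of P" "R \<subseteq> G" "w \<notin> G" using wR by blast
  moreover have "A - {w} \<subseteq> R" unfolding R_def by (rule hull_subset)
  ultimately show ?thesis unfolding A_def by blast
qed

lemma illuminated_incidence_polytope:
  fixes P :: "(real ^ 'n) set"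
  assumes "full_dim_polytope P" "illuminated P"
  shows "illuminated_incidence (vertices P) {F \<inter> vertices P |F. F facet_of P}
           (inner_diagonal P) CARD('n)"
proof -
  have P: "polytope P" "aff_dim P = int CARD('n)"
    using assms(1) by (auto simp: full_dim_polytope_def)
  have dim: "1 \<le> aff_dim P" using P(2) zero_less_card_finite[where 'a = 'n] by linarith
  show ?thesis
  proof
    show "finite (vertices P)" using finite_vertices P by blast
    show "CARD('n) \<le> card A" if "A \<in> {F \<inter> vertices P |F. F facet_of P}" for A
      using that card_facet_vertices[OF P(1)] P(2) by auto
    show "inner_diagonal P v w \<Longrightarrow> inner_diagonal P w v" for v w by (rule inner_diagonal_sym)
    show "w \<notin> A" if "A \<in> {F \<inter> vertices P |F. F facet_of P}" "inner_diagonal P v w" "v \<in> A"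
      for A v w using that inner_diagonal_not_in_facet by blast
    show "\<exists>A\<in>{F \<inter> vertices P |F. F facet_of P}. v \<in> A" if "v \<in> vertices P" for v
      using vertex_in_facet[OF P(1) dim that] that by blast
    show "\<exists>w\<in>vertices P. inner_diagonal P v w" if v: "v \<in> vertices P" for v
    proof -
      obtain w where "inner_diagonal P v w" using assms(2) v by (auto simp: illuminated_def)
      moreover from this have "w \<in> vertices P" by (simp add: inner_diagonal_def)
      ultimately show ?thesis by blast
    qed
    show "\<exists>B\<in>{F \<inter> vertices P |F. F facet_of P}. A - {w} \<subseteq> B \<and> w \<notin> B"
      if A: "A \<in> {F \<inter> vertices P |F. F facet_of P}" "card A = CARD('n)" "w \<in> A" "A \<noteq> {w}" for A w
    proof -
      obtain F where F: "F facet_of P" "A = F \<inter> vertices P" using A(1) by blast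
      obtain G where "G facet_of P" "F \<inter> vertices P - {w} \<subseteq> G" "w \<notin> G"
        using simplex_facet_flip[OF P(1) F(1), of w] A(2-) F(2) P(2) by auto
      then show ?thesis using F by blast
    qed
  qed auto
qed

section \<open>Face lattices and vertex-facet incidences\<close>

text \<open>Nonempty proper faces are intersections of facets, and intersections of facets are
  faces. The empty family, whose intersection is \<open>UNIV\<close>, stands for \<open>P\<close>
  itself; the empty face is added by hand.\<close>

lemma face_vertex_sets:
  fixes P :: "'a::euclidean_space set" and p :: "'i \<Rightarrow> 'a"
  assumes P: "polytope P" and p: "bij_betw p UNIV (vertices P)"
  shows "(\<lambda>F. p -` F) ` {F. F face_of P} =
         insert {} (Inter ` Pow ((\<lambda>F. p -` F) ` {F. F facet_of P}))"
    (is "?faces = insert {} (Inter ` Pow ?facets)")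
proof
  have pP: "p -` P = UNIV"
    using p by (auto simp: bij_betw_def vertices_def extreme_point_of_def)
  show "?faces \<subseteq> insert {} (Inter ` Pow ?facets)"
  proof
    fix X assume "X \<in> ?faces"
    then obtain F where F: "F face_of P" "X = p -` F" by blast
    consider "F = {}" | "F = P" | "F \<noteq> {}" "F \<noteq> P" by blast
    then show "X \<in> insert {} (Inter ` Pow ?facets)"
    proof cases
      case 1
      then show ?thesis using F by simp
    next
      case 2
      then have "X = \<Inter>{}" using F pP by simp
      then show ?thesis by blast
    next
      case 3
      then have "F = \<Inter>{G. G facet_of P \<and> F \<subseteq> G}"
        using face_of_polyhedron[OF polytope_imp_polyhedron[OF P] F(1)] by blast
      then have "X = \<Inter>((\<lambda>F. p -` F) ` {G. G facet_of P \<and> F \<subseteq> G})"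
        using F by blast
      moreover have "(\<lambda>F. p -` F) ` {G. G facet_of P \<and> F \<subseteq> G} \<in> Pow ?facets" by blast
      ultimately show ?thesis by blast
    qed
  qed
  show "insert {} (Inter ` Pow ?facets) \<subseteq> ?faces"
  proof
    fix X assume "X \<in> insert {} (Inter ` Pow ?facets)"
    then consider "X = {}" | \<A> where "\<A> \<subseteq> {F. F facet_of P}" "X = \<Inter>((\<lambda>F. p -` F) ` \<A>)"
      by (auto simp: subset_image_iff)
    then show "X \<in> ?faces"
    proof cases
      case 1
      then have "X = p -` {}" by simp
      then show ?thesis using empty_face_of by blast
    next
      case 2
      show ?thesis
      proof (cases "\<A> = {}")
        case True
        then have "X = p -` P" using 2 pP by simp
        then show ?thesis using face_of_refl[OF polytope_imp_convex[OF P]] by blast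
      next
        case False
        then have "\<Inter>\<A> face_of P"
          using 2 by (intro face_of_Inter) (auto simp: facet_of_def)
        moreover have "X = p -` \<Inter>\<A>" using 2 by blast
        ultimately show ?thesis by blast
      qed
    qed
  qed
qed

text \<open>The facets determine the label sets of all faces, and a face is the hull of its labelled
  vertices. So inclusion of faces can be tested on labels, and reading the labels in
  \<open>Q\<close> gives the isomorphism.\<close>

lemma combinatorially_equivalent_if_same_incidences:
  fixes P :: "'a::euclidean_space set" and Q :: "'b::euclidean_space set"
    and p :: "'i \<Rightarrow> 'a" and q :: "'i \<Rightarrow> 'b"
  assumes P: "polytope P" and p: "bij_betw p UNIV (vertices P)"
    and Q: "polytope Q" and q: "bij_betw q UNIV (vertices Q)"
    and eq: "(\<lambda>F. p -` F) ` {F. F facet_of P} = (\<lambda>F. q -` F) ` {F. F facet_of Q}"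
  shows "combinatorially_equivalent P Q"
proof -
  have faces: "(\<lambda>F. p -` F) ` {F. F face_of P} = (\<lambda>F. q -` F) ` {F. F face_of Q}"
    using face_vertex_sets[OF P p] face_vertex_sets[OF Q q] eq by simp
  have hullP: "convex hull (p ` (p -` F)) = F" if "F face_of P" for F
    using convex_hull_face_vertices[OF P that] p by (simp add: bij_betw_def Int_commute)
  have hullQ: "convex hull (q ` (q -` F)) = F" if "F face_of Q" for F
    using convex_hull_face_vertices[OF Q that] q by (simp add: bij_betw_def Int_commute)
  define f where "f F = convex hull (q ` (p -` F))" for F
  have f: "f F face_of Q" "q -` f F = p -` F" if "F face_of P" for F
  proof -
    have "p -` F \<in> (\<lambda>F. q -` F) ` {F. F face_of Q}" using that faces by blast
    then obtain G where G: "G face_of Q" "p -` F = q -` G" by blast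
    then have "f F = G" using hullQ by (simp add: f_def)
    then show "f F face_of Q" "q -` f F = p -` F" using G by auto
  qed
  have iff: "F \<subseteq> F' \<longleftrightarrow> f F \<subseteq> f F'" if "F face_of P" "F' face_of P" for F F'
  proof
    assume "F \<subseteq> F'"
    then show "f F \<subseteq> f F'" unfolding f_def by (intro hull_mono) auto
  next
    assume "f F \<subseteq> f F'"
    then have "p -` F \<subseteq> p -` F'" using f that by (metis vimage_mono)
    then show "F \<subseteq> F'" using hullP that by (metis hull_mono image_mono)
  qed
  have "bij_betw f {F. F face_of P} {G. G face_of Q}"
    unfolding bij_betw_def
  proof
    show "inj_on f {F. F face_of P}" using iff by (intro inj_onI) (simp add: subset_antisym)
    show "f ` {F. F face_of P} = {G. G face_of Q}"
    proof
      show "f ` {F. F face_of P} \<subseteq> {G. G face_of Q}" using f by auto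
      show "{G. G face_of Q} \<subseteq> f ` {F. F face_of P}"
      proof
        fix G assume "G \<in> {G. G face_of Q}"
        then have G: "G face_of Q" by simp
        then have "q -` G \<in> (\<lambda>F. p -` F) ` {F. F face_of P}" using faces by blast
        then obtain F where F: "F face_of P" "q -` G = p -` F" by blast
        then have "f F = G" using hullQ[OF G] by (simp add: f_def)
        then show "G \<in> f ` {F. F face_of P}" using F by blast
      qed
    qed
  qed
  then show ?thesis unfolding combinatorially_equivalent_def using iff by blast
qed

text \<open>Both polytopes admit labellings for which the facets are precisely the graphs of all
  functions \<open>s\<close>.\<close>

lemma combinatorially_equivalent_illuminated:
  fixes P Q :: "(real ^ 'n) set"
  assumes "CARD('n) \<le> 5"
    and "full_dim_polytope P" "illuminated P" "card (vertices P) = 2 * CARD('n)"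
    and "full_dim_polytope Q" "illuminated Q" "card (vertices Q) = 2 * CARD('n)"
  shows "combinatorially_equivalent P Q"
proof -
  have *: "\<exists>p :: 'n \<times> bool \<Rightarrow> real ^ 'n. bij_betw p UNIV (vertices K) \<and>
      (\<lambda>F. p -` F) ` {F. F facet_of K} = range (\<lambda>s. range (\<lambda>i. (i, s i)))"
    if K: "full_dim_polytope K" "illuminated K" "card (vertices K) = 2 * CARD('n)"
    for K :: "(real ^ 'n) set"
  proof -
    interpret illuminated_incidence "vertices K" "{F \<inter> vertices K |F. F facet_of K}"
      "inner_diagonal K" "CARD('n)"
      using K by (intro illuminated_incidence_polytope)
    obtain p :: "'n \<times> bool \<Rightarrow> real ^ 'n" where p: "bij_betw p UNIV (vertices K)"
        "\<And>i. inner_diagonal K (p (i, True)) (p (i, False))"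
      using ex_paired_labelling[OF K(3) refl assms(1)] by blast
    have "p -` (F \<inter> vertices K) = p -` F" for F
      using p(1) by (auto simp: bij_betw_def)
    then have "(\<lambda>A. p -` A) ` {F \<inter> vertices K |F. F facet_of K} = (\<lambda>F. p -` F) ` {F. F facet_of K}"
      unfolding setcompr_eq_image image_image by simp
    then show ?thesis using facets_eq_transversals[OF p refl] p(1) by auto
  qed
  obtain p :: "'n \<times> bool \<Rightarrow> real ^ 'n" where p: "bij_betw p UNIV (vertices P)"
      "(\<lambda>F. p -` F) ` {F. F facet_of P} = range (\<lambda>s. range (\<lambda>i. (i, s i)))"
    using *[of P] assms by blast
  obtain q :: "'n \<times> bool \<Rightarrow> real ^ 'n" where q: "bij_betw q UNIV (vertices Q)"
      "(\<lambda>F. q -` F) ` {F. F facet_of Q} = range (\<lambda>s. range (\<lambda>i. (i, s i)))"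
    using *[of Q] assms by blast
  show ?thesis
    using combinatorially_equivalent_if_same_incidences[OF _ p(1) _ q(1)] p(2) q(2) assms
    by (simp add: full_dim_polytope_def)
qed

section \<open>The crosspolytope\<close>

text \<open>The functional \<open>x \<mapsto> a \<bullet> x\<close> is 1 at the generator
  \<open>a\<close> and at most 0 at all others, so no generator lies in the hull of the
  rest.\<close>

lemma vertices_crosspolytope:
  "vertices (crosspolytope :: (real ^ 'n) set) = (\<Union>i. {axis i 1, - axis i 1})"
proof -
  let ?S = "\<Union>i::'n. {axis i 1, - axis i (1::real)}"
  have "a \<notin> convex hull (?S - {a})" if aS: "a \<in> ?S" for a
  proof -
    obtain i where a: "a = axis i 1 \<or> a = - axis i 1" using aS by blast
    have "a \<bullet> x \<le> 0" if "x \<in> ?S - {a}" for x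
      using that a by (auto simp: inner_axis_axis)
    then have "convex hull (?S - {a}) \<subseteq> {x. a \<bullet> x \<le> 0}"
      by (intro hull_minimal convex_halfspace_le) blast
    moreover have "a \<bullet> a = 1" using a by (auto simp: inner_axis_axis)
    ultimately show ?thesis by auto
  qed
  moreover have "compact ?S" by (intro finite_imp_compact) auto
  ultimately show ?thesis
    using extreme_point_of_convex_hull_convex_independent[of ?S]
    unfolding vertices_def crosspolytope_def by blast
qed

text \<open>The affine hull contains 0 as a midpoint of antipodal generators, so the affine
  dimension is the linear one.\<close>

lemma full_dim_polytope_crosspolytope: "full_dim_polytope (crosspolytope :: (real ^ 'n) set)"
proof -
  let ?S = "\<Union>i::'n. {axis i 1, - axis i (1::real)}"
  have "0 \<in> affine hull ?S"
  proof -
    have "midpoint (axis i 1) (- axis i 1) \<in> convex hull ?S" for i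
      by (rule subsetD[OF closed_segment_subset_convex_hull midpoint_in_closed_segment])
        (auto intro: hull_inc)
    then show ?thesis using convex_hull_subset_affine_hull by (auto simp: midpoint_def)
  qed
  moreover have "dim ?S = CARD('n)"
  proof -
    have "(Basis :: (real ^ 'n) set) \<subseteq> ?S" by (auto simp: Basis_vec_def)
    then have "span (Basis :: (real ^ 'n) set) \<subseteq> span ?S" by (rule span_mono)
    then have "span ?S = UNIV" by auto
    then show ?thesis using dim_span[of ?S] by simp
  qed
  ultimately have "aff_dim (crosspolytope :: (real ^ 'n) set) = int CARD('n)"
    unfolding crosspolytope_def aff_dim_convex_hull by (simp add: aff_dim_zero)
  moreover have "polytope (crosspolytope :: (real ^ 'n) set)"
    unfolding crosspolytope_def by (intro polytope_convex_hull) auto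
  ultimately show ?thesis by (simp add: full_dim_polytope_def)
qed

text \<open>The interior is nonempty, convex and symmetric under negation, so it contains the
  midpoint of some \<open>y\<close> and \<open>- y\<close>.\<close>

lemma zero_in_interior_crosspolytope: "0 \<in> interior (crosspolytope :: (real ^ 'n) set)"
proof -
  let ?K = "crosspolytope :: (real ^ 'n) set"
  have conv: "convex ?K" by (simp add: crosspolytope_def)
  have "aff_dim ?K = int DIM(real ^ 'n)"
    using full_dim_polytope_crosspolytope[where 'n = 'n] by (simp add: full_dim_polytope_def)
  then have "interior ?K = rel_interior ?K" by (simp add: interior_rel_interior_gen)
  moreover have "?K \<noteq> {}" by (simp add: crosspolytope_def)
  ultimately obtain y where y: "y \<in> interior ?K"
    using rel_interior_eq_empty[OF conv] by blast
  have "uminus ` ?K = convex hull (uminus ` (\<Union>i::'n. {axis i 1, - axis i 1}))"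
    unfolding crosspolytope_def by (rule convex_hull_linear_image) (rule linear_uminus)
  also have "uminus ` (\<Union>i::'n. {axis i 1, - axis i 1}) = (\<Union>i::'n. {axis i 1, - axis i (1::real)})"
    unfolding image_UN by (intro SUP_cong) auto
  finally have "uminus ` ?K = ?K" by (simp add: crosspolytope_def)
  then have "- y \<in> interior ?K" using y interior_negations[of ?K] by (metis image_eqI)
  then have "midpoint y (- y) \<in> interior ?K"
    using y convex_interior[OF conv] closed_segment_subset midpoint_in_closed_segment by blast
  then show ?thesis by (simp add: midpoint_def)
qed

text \<open>Antipodal vertices are joined by a segment through the interior point 0.\<close>

lemma illuminated_crosspolytope: "illuminated (crosspolytope :: (real ^ 'n) set)"
  unfolding illuminated_def
proof
  fix v :: "real ^ 'n" assume v: "v \<in> vertices crosspolytope"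
  then have "- v \<in> vertices crosspolytope" "v \<noteq> 0"
    unfolding vertices_crosspolytope by (auto simp: axis_eq_0_iff)
  moreover from this have "v \<noteq> - v"
    by (metis add.right_inverse scaleR_2 scaleR_eq_0_iff zero_neq_numeral)
  moreover have "0 \<in> closed_segment v (- v)"
    using midpoint_in_closed_segment[of v "- v"] by (simp add: midpoint_def)
  ultimately have "inner_diagonal crosspolytope v (- v)"
    using v zero_in_interior_crosspolytope by (auto simp: inner_diagonal_def)
  then show "\<exists>w. inner_diagonal crosspolytope v w" by blast
qed

lemma card_vertices_crosspolytope:
  "card (vertices (crosspolytope :: (real ^ 'n) set)) = 2 * CARD('n)"
proof -
  have neq: "axis i 1 \<noteq> - axis j (1::real)" for i j :: 'n
  proof
    assume "axis i 1 = - axis j (1::real)"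
    then have "axis i 1 $ i = (- axis j (1::real)) $ i" by simp
    then show False by (simp add: axis_def split: if_splits)
  qed
  have "card {axis i 1, - axis i (1::real)} = 2" for i :: 'n using neq[of i i] by simp
  moreover have "{axis i 1, - axis i (1::real)} \<inter> {axis j 1, - axis j 1} = {}" if "i \<noteq> j" for i j :: 'n
    using that neq[of i j] neq[of j i] by (auto simp: axis_eq_axis)
  ultimately have "card (\<Union>i::'n. {axis i 1, - axis i (1::real)}) = (\<Sum>i\<in>(UNIV::'n set). 2)"
    by (subst card_UN_disjoint) simp_all
  then show ?thesis by (simp add: vertices_crosspolytope)
qed

section \<open>The Mani number in low dimensions\<close>

text \<open>The minimum is \<open>2 * d\<close> once \<open>d - 1 \<le> 2 * sqrt d\<close>; for
  \<open>d \<ge> 1\<close>, squaring turns this into \<open>d * (d - 6) + 1 \<le> 0\<close>.\<close>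

lemma mani_number_le_5:
  assumes "d \<le> 5"
  shows "mani_number d = 2 * d"
proof -
  have "real d - 1 \<le> 2 * sqrt (real d)"
  proof (cases "d = 0")
    case False
    have "(real d - 1)\<^sup>2 \<le> 4 * real d"
    proof -
      \<comment> \<open>Both \<open>d\<close> and \<open>6 - d\<close> are at least 1, hence so is
        their product.\<close>
      have "real d * (real d - 6) + 1 \<le> 0"
        using assms False mult_mono[of 1 "real d" 1 "6 - real d"] by (simp add: algebra_simps)
      then show ?thesis by (simp add: power2_eq_square algebra_simps)
    qed
    then have "real d - 1 \<le> sqrt (4 * real d)" by (rule real_le_rsqrt)
    then show ?thesis by (simp add: real_sqrt_mult)
  qed simp
  then have "d - 1 \<le> nat \<lceil>2 * sqrt (real d)\<rceil>" by linarith
  then show ?thesis by (auto simp: mani_number_def)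
qed

theorem theorem2p5:
  assumes "1 \<le> CARD('n::finite)" and "CARD('n) \<le> 5"
  shows "mani_polytope (crosspolytope :: (real ^ 'n) set) \<and>
    (\<forall>P :: (real ^ 'n) set. mani_polytope P \<longrightarrow>
       combinatorially_equivalent P (crosspolytope :: (real ^ 'n) set))"
proof -
  have "mani_polytope K \<longleftrightarrow> full_dim_polytope K \<and> illuminated K \<and> card (vertices K) = 2 * CARD('n)"
    for K :: "(real ^ 'n) set"
    using mani_number_le_5[OF assms(2)] by (simp add: mani_polytope_def)
  then show ?thesis
    using full_dim_polytope_crosspolytope illuminated_crosspolytope card_vertices_crosspolytope
      combinatorially_equivalent_illuminated[OF assms(2)] by blast
qed

end
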